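(* Let $X$ be a finite topological space and let $A\subset X$. Then the boundary of $A$ is $$\partial A=\{b\in X : b\leq a \text{ for some } a\in A \text{ and } b\leq c \text{ for some } c\in X\setminus A\}.$$
   Context: For a point $x$ of a finite topological space $X$, $U_x$ denotes the intersection of all open sets containing $x$, i.e. the smallest open set containing $x$. For $x,y\in X$ one writes $y\geq x$ (equivalently $x\leq y$) if $U_y\subseteq U_x$. The boundary of $A$ is $\partial A=\overline{A}\cap\overline{X\setminus A}$. *)

theory Defs
  imports "HOL-Analysis.Abstract_Topology"
begin

text \<open>In a finite space the intersection below is itself open, so it is the smallest open set
  containing \<open>x\<close>. It is meaningful only for points \<open>x\<close> of the space: for other \<open>x\<close> the
  intersection is over the empty family.\<close>

definition min_open :: "'a topology \<Rightarrow> 'a \<Rightarrow> 'a set" where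
  "min_open X x = \<Inter>{U. openin X U \<and> x \<in> U}"

text \<open>\<open>point_le X x y\<close> means \<open>x \<le> y\<close>: the larger point has the smaller neighbourhood.\<close>

definition point_le :: "'a topology \<Rightarrow> 'a \<Rightarrow> 'a \<Rightarrow> bool" where
  "point_le X x y \<longleftrightarrow> min_open X y \<subseteq> min_open X x"

text \<open>The library defines \<^const>\<open>frontier_of\<close> as closure minus interior. It is the boundary
  in the sense of the intersection of the closures of \<open>A\<close> and of its complement.\<close>

lemma frontier_of_eq_closures_Int:
  "X frontier_of A = X closure_of A \<inter> X closure_of (topspace X - A)"
  by (rule frontier_of_closures)

end

theory Submission
  imports Defs
begin

text \<open>Finiteness makes \<open>min_open X x\<close> open, hence the least neighbourhood of
  \<open>x\<close>. So \<open>x\<close> lies in the closure of \<open>S\<close> as soon as this one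
  neighbourhood meets \<open>S\<close>, that is, when some \<open>s\<close> in \<open>S\<close> lies
  above \<open>x\<close> (\<open>closure_of_eq_point_le\<close>). Applying this to \<open>A\<close>
  and to its complement and intersecting gives the boundary.\<close>

lemma openin_min_open:
  assumes "finite (topspace X)" and "x \<in> topspace X"
  shows "openin X (min_open X x)"
  unfolding min_open_def
proof (rule openin_Inter)
  have "{U. openin X U \<and> x \<in> U} \<subseteq> Pow (topspace X)"
    by (auto dest: openin_subset)
  then show "finite {U. openin X U \<and> x \<in> U}"
    using assms(1) by (meson finite_Pow_iff finite_subset)
  show "{U. openin X U \<and> x \<in> U} \<noteq> {}"
    using assms(2) by auto
qed auto

lemma mem_min_open_self: "x \<in> min_open X x"
  by (auto simp: min_open_def)

lemma min_open_subset: "openin X U \<Longrightarrow> x \<in> U \<Longrightarrow> min_open X x \<subseteq> U"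
  by (auto simp: min_open_def)

text \<open>An open set containing \<open>y\<close> contains all of \<open>min_open X y\<close>. No
  condition on \<open>y\<close> is imposed: outside the space \<open>min_open X y\<close> is
  \<open>UNIV\<close>, and both sides are false.\<close>

lemma point_le_iff_mem_min_open:
  assumes "finite (topspace X)" and "x \<in> topspace X"
  shows "point_le X x y \<longleftrightarrow> y \<in> min_open X x"
  unfolding point_le_def
  using openin_min_open[OF assms] mem_min_open_self min_open_subset by (metis subsetD)

lemma closure_of_eq_point_le:
  assumes "finite (topspace X)"
  shows "X closure_of S = {x \<in> topspace X. \<exists>s\<in>S. point_le X x s}"
proof -
  have "x \<in> X closure_of S \<longleftrightarrow> (\<exists>s\<in>S. point_le X x s)" if "x \<in> topspace X" for x
    unfolding in_closure_of point_le_iff_mem_min_open[OF assms that]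
    \<comment> \<open>\<open>min_open X x\<close> is itself one of the neighbourhoods to be tested,
      and a point of \<open>S\<close> in it lies in all the others.\<close>
    using that openin_min_open[OF assms that] mem_min_open_self[of x X] min_open_subset[of X _ x]
    by blast
  then show ?thesis
    using closure_of_subset_topspace[of X S] by blast
qed

theorem proposition3p9:
  fixes X :: "'a topology" and A :: "'a set"
  assumes "finite (topspace X)" and "A \<subseteq> topspace X"
  shows "X frontier_of A =
    {b \<in> topspace X. (\<exists>a\<in>A. point_le X b a) \<and> (\<exists>c\<in>topspace X - A. point_le X b c)}"
  unfolding frontier_of_eq_closures_Int closure_of_eq_point_le[OF assms(1)] by blast

end
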